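(* Let $X,Y$ be topological spaces, let $\phi:X\to Y$ be a closed $H^*$-$gH^*$-continuous injection, and suppose that $Y$ is $H^*$-normal. Then $X$ is $H^*$-normal.
   Context: No separation axioms are assumed. Let $X$ be a topological space and $A\subseteq X$. $A$ is semi-closed if $\operatorname{int}(\operatorname{cl}(A))\subseteq A$, and semi-open if its complement is semi-closed; $s\text{-}\operatorname{cl}(A)$ is the intersection of all semi-closed sets containing $A$. $A$ is $w$-closed if $\operatorname{cl}(A)\subseteq U$ whenever $A\subseteq U$ and $U$ is semi-open; $w$-open means complement of $w$-closed. $A$ is $h$-closed if $s\text{-}\operatorname{cl}(A)\subseteq U$ whenever $A\subseteq U$ and $U$ is $w$-open; $h\text{-}\operatorname{cl}(A)$ is the intersection of all $h$-closed sets containing $A$. A set $V$ is an $\alpha^*$-set if $\operatorname{int}(\operatorname{cl}(\operatorname{int}(V)))=\operatorname{int}(V)$; a $C$-set is a set of the form $U\cap V$ with $U$ open and $V$ an $\alpha^*$-set. $A$ is $hCg$-closed if $h\text{-}\operatorname{cl}(A)\subseteq U$ whenever $A\subseteq U$ and $U$ is a $C$-set; $hCg$-open means complement of $hCg$-closed. $A$ is $H^*$-closed if $h\text{-}\operatorname{cl}(A)\subseteq U$ whenever $A\subseteq U$ and $U$ is $hCg$-open; $H^*$-open means complement of $H^*$-closed. $H^*\text{-}\operatorname{cl}(A)$ is the intersection of all $H^*$-closed sets containing $A$. $A$ is $gH^*$-closed if $H^*\text{-}\operatorname{cl}(A)\subseteq U$ whenever $A\subseteq U$ and $U$ is $H^*$-open.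 $X$ is $H^*$-normal if for any pair of disjoint closed sets $A,B\subseteq X$ there exist disjoint $H^*$-open sets $U,V$ with $A\subseteq U$ and $B\subseteq V$. A function $\phi:X\to Y$ is closed if it maps closed sets to closed sets; it is $H^*$-$gH^*$-continuous if $\phi^{-1}(K)$ is $gH^*$-closed in $X$ for every $H^*$-closed set $K\subseteq Y$. *)

theory Defs
  imports "HOL-Analysis.Abstract_Topology"
begin

text \<open>
  Spaces are values of type \<open>'a topology\<close>, so "a set" always means a subset of the carrier
  \<^term>\<open>topspace X\<close> and complements are taken in it. The three closure operators below are
  intersections over all sets of the given kind containing \<open>A\<close>; for \<open>A\<close> within the carrier these
  families contain the carrier itself, so the intersection is never empty-indexed.
\<close>

definition semi_closed_in :: "'a topology \<Rightarrow> 'a set \<Rightarrow> bool" where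
  "semi_closed_in X A \<longleftrightarrow> A \<subseteq> topspace X \<and> X interior_of (X closure_of A) \<subseteq> A"

definition semi_open_in :: "'a topology \<Rightarrow> 'a set \<Rightarrow> bool" where
  "semi_open_in X A \<longleftrightarrow> A \<subseteq> topspace X \<and> semi_closed_in X (topspace X - A)"

definition s_cl :: "'a topology \<Rightarrow> 'a set \<Rightarrow> 'a set" where
  "s_cl X A = \<Inter>{F. semi_closed_in X F \<and> A \<subseteq> F}"

definition w_closed_in :: "'a topology \<Rightarrow> 'a set \<Rightarrow> bool" where
  "w_closed_in X A \<longleftrightarrow> A \<subseteq> topspace X \<and>
     (\<forall>U. semi_open_in X U \<and> A \<subseteq> U \<longrightarrow> X closure_of A \<subseteq> U)"

definition w_open_in :: "'a topology \<Rightarrow> 'a set \<Rightarrow> bool" where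
  "w_open_in X A \<longleftrightarrow> A \<subseteq> topspace X \<and> w_closed_in X (topspace X - A)"

definition h_closed_in :: "'a topology \<Rightarrow> 'a set \<Rightarrow> bool" where
  "h_closed_in X A \<longleftrightarrow> A \<subseteq> topspace X \<and>
     (\<forall>U. w_open_in X U \<and> A \<subseteq> U \<longrightarrow> s_cl X A \<subseteq> U)"

definition h_cl :: "'a topology \<Rightarrow> 'a set \<Rightarrow> 'a set" where
  "h_cl X A = \<Inter>{F. h_closed_in X F \<and> A \<subseteq> F}"

definition alpha_star_set_in :: "'a topology \<Rightarrow> 'a set \<Rightarrow> bool" where
  "alpha_star_set_in X V \<longleftrightarrow> V \<subseteq> topspace X \<and>
     X interior_of (X closure_of (X interior_of V)) = X interior_of V"

definition C_set_in :: "'a topology \<Rightarrow> 'a set \<Rightarrow> bool" where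
  "C_set_in X A \<longleftrightarrow> (\<exists>U V. openin X U \<and> alpha_star_set_in X V \<and> A = U \<inter> V)"

definition hCg_closed_in :: "'a topology \<Rightarrow> 'a set \<Rightarrow> bool" where
  "hCg_closed_in X A \<longleftrightarrow> A \<subseteq> topspace X \<and>
     (\<forall>U. C_set_in X U \<and> A \<subseteq> U \<longrightarrow> h_cl X A \<subseteq> U)"

definition hCg_open_in :: "'a topology \<Rightarrow> 'a set \<Rightarrow> bool" where
  "hCg_open_in X A \<longleftrightarrow> A \<subseteq> topspace X \<and> hCg_closed_in X (topspace X - A)"

definition Hstar_closed_in :: "'a topology \<Rightarrow> 'a set \<Rightarrow> bool" where
  "Hstar_closed_in X A \<longleftrightarrow> A \<subseteq> topspace X \<and>
     (\<forall>U. hCg_open_in X U \<and> A \<subseteq> U \<longrightarrow> h_cl X A \<subseteq> U)"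

definition Hstar_open_in :: "'a topology \<Rightarrow> 'a set \<Rightarrow> bool" where
  "Hstar_open_in X A \<longleftrightarrow> A \<subseteq> topspace X \<and> Hstar_closed_in X (topspace X - A)"

definition Hstar_cl :: "'a topology \<Rightarrow> 'a set \<Rightarrow> 'a set" where
  "Hstar_cl X A = \<Inter>{F. Hstar_closed_in X F \<and> A \<subseteq> F}"

definition gHstar_closed_in :: "'a topology \<Rightarrow> 'a set \<Rightarrow> bool" where
  "gHstar_closed_in X A \<longleftrightarrow> A \<subseteq> topspace X \<and>
     (\<forall>U. Hstar_open_in X U \<and> A \<subseteq> U \<longrightarrow> Hstar_cl X A \<subseteq> U)"

definition Hstar_normal_space :: "'a topology \<Rightarrow> bool" where
  "Hstar_normal_space X \<longleftrightarrow>
     (\<forall>A B. closedin X A \<and> closedin X B \<and> disjnt A B \<longrightarrow>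
        (\<exists>U V. Hstar_open_in X U \<and> Hstar_open_in X V \<and> disjnt U V \<and> A \<subseteq> U \<and> B \<subseteq> V))"

definition Hstar_gHstar_continuous_map ::
    "'a topology \<Rightarrow> 'b topology \<Rightarrow> ('a \<Rightarrow> 'b) \<Rightarrow> bool" where
  "Hstar_gHstar_continuous_map X Y \<phi> \<longleftrightarrow>
     \<phi> \<in> topspace X \<rightarrow> topspace Y \<and>
     (\<forall>K. Hstar_closed_in Y K \<longrightarrow> gHstar_closed_in X {x \<in> topspace X. \<phi> x \<in> K})"

end

theory Submission
  imports Defs
begin

text \<open>
  Transporting separating sets back along \<open>\<phi>\<close> requires that \<open>H\<^sup>*\<close>-closures are
  \<open>H\<^sup>*\<close>-closed. This holds because a set \<open>A\<close> is \<open>H\<^sup>*\<close>-closed iff every closed point of the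
  interior of the closure of \<open>A\<close> lies in \<open>A\<close>, a condition which is stable under intersections.
  For the nontrivial direction, suppose that such an \<open>A\<close> misses an \<open>hCg\<close>-closed set \<open>F\<close> and that
  \<open>x \<in> F\<close> lies in the \<open>h\<close>-closure of \<open>A\<close>. Since the closure of \<open>A\<close> with \<open>x\<close> removed is not
  \<open>h\<close>-closed, the closure of \<open>{x}\<close> is a clopen indiscrete set with more than one point. It
  meets both \<open>A\<close> and \<open>F\<close>, but an \<open>hCg\<close>-closed set contains every such set that it meets.
\<close>

section \<open>Semi-closures and \<open>h\<close>-closures\<close>

lemma semi_closed_in_closedin: "closedin X A \<Longrightarrow> semi_closed_in X A"
  unfolding semi_closed_in_def
  by (metis closedin_subset closure_of_closedin interior_of_subset)

lemma interior_closure_subset_s_cl: "X interior_of (X closure_of A) \<subseteq> s_cl X A"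
  unfolding s_cl_def semi_closed_in_def
  by (blast dest: interior_of_mono[OF closure_of_mono])

text \<open>Adjoining the interior of the closure does not enlarge the closure, so the right-hand
  side is itself semi-closed.\<close>

lemma s_cl_subset:
  assumes "A \<subseteq> topspace X"
  shows "s_cl X A \<subseteq> A \<union> X interior_of (X closure_of A)"
proof -
  let ?B = "A \<union> X interior_of (X closure_of A)"
  have "?B \<subseteq> X closure_of A"
    using assms closure_of_subset interior_of_subset by fastforce
  then have "X closure_of ?B \<subseteq> X closure_of A"
    by (simp add: closure_of_minimal)
  then have "semi_closed_in X ?B"
    unfolding semi_closed_in_def
    using assms interior_of_mono interior_of_subset_topspace[of X] by blast
  then show ?thesis
    unfolding s_cl_def by blast
qed

lemma w_closed_in_closedin: "closedin X A \<Longrightarrow> w_closed_in X A"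
  unfolding w_closed_in_def by (simp add: closedin_subset closure_of_closedin)

lemma h_closed_in_closedin: "closedin X A \<Longrightarrow> h_closed_in X A"
  unfolding h_closed_in_def s_cl_def
  using semi_closed_in_closedin closedin_subset by blast

lemma h_closed_in_disjoint_w_closed_in:
  assumes "h_closed_in X H" "w_closed_in X W" "W \<inter> H = {}"
  shows "W \<inter> X interior_of (X closure_of H) = {}"
proof -
  have "w_open_in X (topspace X - W)"
    using assms(2) by (simp add: w_open_in_def w_closed_in_def double_diff)
  then have "s_cl X H \<subseteq> topspace X - W"
    using assms unfolding h_closed_in_def by blast
  then show ?thesis
    using interior_closure_subset_s_cl[of X H] by blast
qed

lemma h_cl_subset: "h_closed_in X H \<Longrightarrow> A \<subseteq> H \<Longrightarrow> h_cl X A \<subseteq> H"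
  unfolding h_cl_def by blast

text \<open>If an \<open>h\<close>-closed \<open>H\<close> containing \<open>A\<close> missed
  \<open>a\<close>, the complement of \<open>{a}\<close> would be a \<open>w\<close>-open set around
  \<open>H\<close>, hence around its semi-closure; but that contains the interior of the closure of
  \<open>H\<close>, where \<open>a\<close> lies.\<close>

lemma in_h_cl:
  assumes "w_closed_in X {a}" "a \<in> X interior_of (X closure_of A)"
  shows "a \<in> h_cl X A"
  unfolding h_cl_def
proof clarify
  fix H assume H: "h_closed_in X H" "A \<subseteq> H"
  then have "a \<in> X interior_of (X closure_of H)"
    using assms(2) by (meson closure_of_mono interior_of_mono subsetD)
  then show "a \<in> H"
    using h_closed_in_disjoint_w_closed_in[OF H(1) assms(1)] by blast
qed

lemma hCg_closed_in_closedin: "closedin X A \<Longrightarrow> hCg_closed_in X A"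
  unfolding hCg_closed_in_def
  using h_cl_subset[OF h_closed_in_closedin] closedin_subset by blast

lemma Hstar_closed_in_closedin: "closedin X A \<Longrightarrow> Hstar_closed_in X A"
  unfolding Hstar_closed_in_def
  using h_cl_subset[OF h_closed_in_closedin] closedin_subset by blast

section \<open>Clopen indiscrete subsets\<close>

text \<open>If nonempty, \<open>C\<close> is closed as the closure of any of its points, and every
  open set meeting \<open>C\<close> contains it.\<close>

definition indiscrete_clopen_in :: "'a topology \<Rightarrow> 'a set \<Rightarrow> bool" where
  "indiscrete_clopen_in X C \<longleftrightarrow> openin X C \<and> (\<forall>x\<in>C. X closure_of {x} = C)"

text \<open>A semi-open \<open>U\<close> meeting \<open>C\<close> contains it: a point of
  \<open>C\<close> outside \<open>U\<close> would put the open set \<open>C\<close> inside the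
  closure of the complement of \<open>U\<close>, hence inside that semi-closed complement.\<close>

lemma indiscrete_clopen_in_singleton_w_closed_in:
  assumes C: "indiscrete_clopen_in X C" and a: "a \<in> C"
  shows "w_closed_in X {a}"
  unfolding w_closed_in_def
proof (intro conjI allI impI)
  have sub: "C \<subseteq> topspace X"
    using C openin_subset unfolding indiscrete_clopen_in_def by blast
  then show "{a} \<subseteq> topspace X"
    using a by blast
  fix U assume U: "semi_open_in X U \<and> {a} \<subseteq> U"
  have "c \<in> U" if "c \<in> C" for c
  proof (rule ccontr)
    assume "c \<notin> U"
    then have "X closure_of {c} \<subseteq> X closure_of (topspace X - U)"
      using sub that by (intro closure_of_mono) blast
    then have "C \<subseteq> X interior_of (X closure_of (topspace X - U))"
      using C that by (simp add: indiscrete_clopen_in_def interior_of_maximal)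
    then show False
      using U a unfolding semi_open_in_def semi_closed_in_def by blast
  qed
  then show "X closure_of {a} \<subseteq> U"
    using C a unfolding indiscrete_clopen_in_def by blast
qed

text \<open>Deleting \<open>a\<close> leaves as interior the complement of the closure of
  \<open>{a}\<close>, that is of \<open>C\<close>. This interior is clopen, so the punctured space
  is an \<alpha>*-set.\<close>

lemma C_set_in_delete:
  assumes C: "indiscrete_clopen_in X C" and "a \<in> C" "x \<in> C" "x \<noteq> a"
  shows "C_set_in X (topspace X - {a})"
proof -
  have cl: "X closure_of {a} = C" "X closure_of {x} = C"
    using assms unfolding indiscrete_clopen_in_def by auto
  have int: "X interior_of (topspace X - {a}) = topspace X - C"
    using cl by (simp add: interior_of_complement)
  have "closedin X (topspace X - C)" "openin X (topspace X - C)"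
    using C cl closedin_closure_of[of X "{a}"]
    by (auto simp: indiscrete_clopen_in_def)
  then have "alpha_star_set_in X (topspace X - {a})"
    unfolding alpha_star_set_in_def int
    by (auto simp: closure_of_closedin interior_of_openin)
  then show ?thesis
    unfolding C_set_in_def
    by (metis Diff_subset inf.absorb2 openin_topspace)
qed

text \<open>For \<open>a\<close> in \<open>C\<close> outside \<open>F\<close>, the two previous
  lemmas conflict: the punctured space is a C-set around \<open>F\<close>, which keeps
  \<open>a\<close> out of \<open>h_cl X F\<close>, while the \<open>w\<close>-closed
  \<open>{a}\<close> lies in the interior of the closure of \<open>F\<close>, which forces
  \<open>a\<close> into it.\<close>

lemma hCg_closed_in_indiscrete_clopen_in:
  assumes F: "hCg_closed_in X F" and C: "indiscrete_clopen_in X C"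
    and x: "x \<in> F" "x \<in> C"
  shows "C \<subseteq> F"
proof
  fix a assume a: "a \<in> C"
  show "a \<in> F"
  proof (rule ccontr)
    assume "a \<notin> F"
    then have "h_cl X F \<subseteq> topspace X - {a}"
      using F C_set_in_delete[OF C a x(2)] x(1) unfolding hCg_closed_in_def by blast
    moreover have "X closure_of {x} \<subseteq> X closure_of F"
      using x(1) by (intro closure_of_mono) blast
    then have "C \<subseteq> X interior_of (X closure_of F)"
      using C x(2) by (simp add: indiscrete_clopen_in_def interior_of_maximal)
    then have "a \<in> h_cl X F"
      using in_h_cl[OF indiscrete_clopen_in_singleton_w_closed_in[OF C a]] a by blast
    ultimately show False by blast
  qed
qed

lemma closure_of_singleton_mono:
  "y \<in> X closure_of {x} \<Longrightarrow> X closure_of {y} \<subseteq> X closure_of {x}"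
  by (simp add: closure_of_minimal)

text \<open>Let \<open>y\<close> be another point of the closure. If \<open>{y}\<close> were
  semi-closed, its complement would be semi-open around \<open>W\<close>, so the closure of
  \<open>W\<close>, which contains \<open>y\<close>, would avoid it. Hence the closure of
  \<open>{y}\<close> has nonempty interior.\<close>

lemma indiscrete_clopen_in_closure_of_singleton:
  assumes x: "x \<in> topspace X" and W: "w_closed_in X W" "x \<in> W"
    and disj: "X closure_of {x} \<inter> W \<subseteq> {x}" and nc: "\<not> closedin X {x}"
  shows "indiscrete_clopen_in X (X closure_of {x})"
proof -
  let ?C = "X closure_of {x}"
  have xC: "x \<in> ?C"
    using x by (simp add: in_closure_of)
  have *: "X closure_of {y} = ?C \<and> {x, y} \<subseteq> X interior_of ?C" if y: "y \<in> ?C" "y \<noteq> x" for y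
  proof -
    have yt: "y \<in> topspace X"
      using y(1) by (simp add: in_closure_of)
    have "\<not> semi_closed_in X {y}"
    proof
      assume "semi_closed_in X {y}"
      then have "semi_open_in X (topspace X - {y})"
        using yt by (simp add: semi_open_in_def double_diff)
      moreover have "W \<subseteq> topspace X - {y}"
        using W(1) disj y unfolding w_closed_in_def by blast
      ultimately have "X closure_of W \<subseteq> topspace X - {y}"
        using W(1) unfolding w_closed_in_def by blast
      moreover have "?C \<subseteq> X closure_of W"
        using W(2) by (intro closure_of_mono) blast
      ultimately show False
        using y(1) by blast
    qed
    then obtain z where z: "z \<in> X interior_of (X closure_of {y})"
      using yt unfolding semi_closed_in_def by blast
    let ?O = "X interior_of (X closure_of {y})"
    have zy: "z \<in> X closure_of {y}"
      using z interior_of_subset by fast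
    \<comment> \<open>An open set meeting the closure of a point contains that point; this is
      applied first to \<open>y\<close>, then to \<open>x\<close>.\<close>
    then have yO: "y \<in> ?O"
      using z unfolding in_closure_of by (metis openin_interior_of singletonD)
    then have xO: "x \<in> ?O"
      using y(1) unfolding in_closure_of by (metis openin_interior_of singletonD)
    then have "x \<in> X closure_of {y}"
      using interior_of_subset by fast
    then have "X closure_of {y} = ?C"
      using closure_of_singleton_mono y(1) by (metis subset_antisym)
    then show ?thesis
      using xO yO by simp
  qed
  have "?C \<noteq> {x}"
    using nc closedin_closure_of[of X "{x}"] by metis
  \<comment> \<open>A second point \<open>y\<close> of \<open>?C\<close> is what places
    \<open>x\<close> itself in the interior.\<close>
  then have "?C \<subseteq> X interior_of ?C"
    using * xC by blast
  then have "openin X ?C"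
    by (metis interior_of_subset openin_interior_of subset_antisym)
  then show ?thesis
    unfolding indiscrete_clopen_in_def using * by blast
qed

section \<open>Characterization of H*-closed sets and their intersections\<close>

lemma Hstar_closed_in_iff:
  "Hstar_closed_in X A \<longleftrightarrow> A \<subseteq> topspace X \<and>
     (\<forall>x \<in> X interior_of (X closure_of A). closedin X {x} \<longrightarrow> x \<in> A)"
  (is "?L \<longleftrightarrow> ?R")
proof
  assume L: ?L
  have "x \<in> A" if x: "x \<in> X interior_of (X closure_of A)" "closedin X {x}" for x
  proof (rule ccontr)
    assume "x \<notin> A"
    moreover have "hCg_open_in X (topspace X - {x})"
      using hCg_closed_in_closedin[OF x(2)] closedin_subset[OF x(2)]
      by (simp add: hCg_open_in_def double_diff)
    ultimately have "h_cl X A \<subseteq> topspace X - {x}"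
      using L unfolding Hstar_closed_in_def by blast
    then show False
      using in_h_cl[OF w_closed_in_closedin[OF x(2)] x(1)] by blast
  qed
  then show ?R
    using L unfolding Hstar_closed_in_def by blast
next
  assume R: ?R
  have "x \<in> U" if U: "hCg_open_in X U" "A \<subseteq> U" and x: "x \<in> h_cl X A" for x U
  proof (rule ccontr)
    assume "x \<notin> U"
    then have xA: "x \<notin> A"
      using U(2) by blast
    have hcl: "h_cl X A \<subseteq> X closure_of A"
      using R by (simp add: h_cl_subset h_closed_in_closedin closure_of_subset)
    then have xcl: "x \<in> X closure_of A" and xt: "x \<in> topspace X"
      using x by (auto simp: in_closure_of)
    \<comment> \<open>\<open>G\<close> contains \<open>A\<close> but not \<open>x\<close>, so it
      would exclude \<open>x\<close> from the \<open>h\<close>-closure of \<open>A\<close> if it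
      were \<open>h\<close>-closed.\<close>
    define G where "G = X closure_of A - {x}"
    have Gt: "G \<subseteq> topspace X"
      unfolding G_def using closure_of_subset_topspace by fast
    have "A \<subseteq> G"
      unfolding G_def using R xA closure_of_subset by fast
    then have "\<not> h_closed_in X G"
      using x h_cl_subset[of X G A] unfolding G_def by blast
    then obtain W where W: "w_open_in X W" "G \<subseteq> W" "\<not> s_cl X G \<subseteq> W"
      using Gt unfolding h_closed_in_def by blast
    have "X closure_of G \<subseteq> X closure_of A"
      unfolding G_def by (simp add: closure_of_minimal)
    then have int: "X interior_of (X closure_of G) \<subseteq> X interior_of (X closure_of A)"
      by (rule interior_of_mono)
    also have "\<dots> \<subseteq> insert x G"
      unfolding G_def using interior_of_subset by fast
    \<comment> \<open>A point of the semi-closure of \<open>G\<close> outside \<open>W\<close> lies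
      in \<open>insert x G\<close> but not in \<open>G\<close>, so it is \<open>x\<close>.\<close>
    finally have xG: "x \<in> X interior_of (X closure_of G)" and xW: "x \<notin> W"
      using W(2,3) s_cl_subset[OF Gt] by blast+
    have nc: "\<not> closedin X {x}"
      using R xA xG int by blast
    define C where "C = X closure_of {x}"
    have "C \<subseteq> X closure_of A"
      unfolding C_def using xcl by (simp add: closure_of_minimal)
    then have "C \<inter> (topspace X - W) \<subseteq> {x}"
      using W(2) unfolding G_def by blast
    then have C: "indiscrete_clopen_in X C"
      unfolding C_def
      using W(1) xW xt nc
      by (intro indiscrete_clopen_in_closure_of_singleton[of _ _ "topspace X - W"])
        (auto simp: w_open_in_def)
    have xC: "x \<in> C"
      unfolding C_def using xt by (simp add: in_closure_of)
    \<comment> \<open>\<open>C\<close> is an open neighbourhood of \<open>x\<close>, which is in the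
      closure of \<open>A\<close>.\<close>
    then obtain a where "a \<in> A" "a \<in> C"
      using C xcl unfolding indiscrete_clopen_in_def in_closure_of by blast
    moreover have "C \<subseteq> topspace X - U"
      using U(1) C xC xt \<open>x \<notin> U\<close>
      by (intro hCg_closed_in_indiscrete_clopen_in[of X _ C x]) (auto simp: hCg_open_in_def)
    ultimately show False
      using U(2) by blast
  qed
  then show ?L
    using R unfolding Hstar_closed_in_def by blast
qed

text \<open>The interior of the closure is monotone, so the pointwise criterion passes from the
  members to the intersection. A member is needed to stay inside the carrier.\<close>

lemma Hstar_closed_in_Inter:
  assumes "\<F> \<noteq> {}" "\<And>F. F \<in> \<F> \<Longrightarrow> Hstar_closed_in X F"
  shows "Hstar_closed_in X (\<Inter>\<F>)"
proof -
  have "X interior_of (X closure_of \<Inter>\<F>) \<subseteq> X interior_of (X closure_of F)" if "F \<in> \<F>" for F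
    using that by (intro interior_of_mono closure_of_mono) blast
  then show ?thesis
    using assms unfolding Hstar_closed_in_iff by blast
qed

lemma Hstar_closed_in_Hstar_cl:
  assumes "A \<subseteq> topspace X"
  shows "Hstar_closed_in X (Hstar_cl X A)"
  unfolding Hstar_cl_def
  using assms Hstar_closed_in_closedin[OF closedin_topspace]
  by (intro Hstar_closed_in_Inter) blast+

section \<open>Pulling back the separation\<close>

lemma subset_Hstar_cl: "A \<subseteq> Hstar_cl X A"
  unfolding Hstar_cl_def by blast

lemma Hstar_open_in_complement: "Hstar_closed_in X A \<Longrightarrow> Hstar_open_in X (topspace X - A)"
  by (simp add: Hstar_open_in_def Hstar_closed_in_def double_diff)

lemma gHstar_closed_in_Hstar_cl_disjoint:
  assumes "gHstar_closed_in X S" "closedin X A" "A \<inter> S = {}"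
  shows "A \<inter> Hstar_cl X S = {}"
proof -
  have "Hstar_open_in X (topspace X - A)"
    using assms(2) by (intro Hstar_open_in_complement Hstar_closed_in_closedin)
  then have "Hstar_cl X S \<subseteq> topspace X - A"
    using assms unfolding gHstar_closed_in_def by blast
  then show ?thesis by blast
qed

theorem theorem4p3:
  fixes X :: "'a topology" and Y :: "'b topology" and \<phi> :: "'a \<Rightarrow> 'b"
  assumes "closed_map X Y \<phi>"
    and "Hstar_gHstar_continuous_map X Y \<phi>"
    and "inj_on \<phi> (topspace X)"
    and "Hstar_normal_space Y"
  shows "Hstar_normal_space X"
  unfolding Hstar_normal_space_def
proof (intro allI impI)
  fix A B assume AB: "closedin X A \<and> closedin X B \<and> disjnt A B"
  then have sub: "A \<subseteq> topspace X" "B \<subseteq> topspace X"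
    by (auto dest: closedin_subset)
  have "closedin Y (\<phi> ` A)" "closedin Y (\<phi> ` B)"
    using assms(1) AB unfolding closed_map_def by auto
  \<comment> \<open>Injectivity enters here.\<close>
  moreover have "disjnt (\<phi> ` A) (\<phi> ` B)"
    using assms(3) AB sub unfolding disjnt_def by (metis image_empty inj_on_image_Int)
  ultimately obtain U V where U: "Hstar_open_in Y U" "\<phi> ` A \<subseteq> U"
    and V: "Hstar_open_in Y V" "\<phi> ` B \<subseteq> V" and UV: "disjnt U V"
    using assms(4) unfolding Hstar_normal_space_def by metis
  \<comment> \<open>The preimages of the complements of \<open>U\<close> and \<open>V\<close> are
    only gH*-closed; the complements of their H*-closures will be the separating sets.\<close>
  define S where "S = {x \<in> topspace X. \<phi> x \<in> topspace Y - U}"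
  define T where "T = {x \<in> topspace X. \<phi> x \<in> topspace Y - V}"
  have S: "gHstar_closed_in X S" and T: "gHstar_closed_in X T"
    using assms(2) U(1) V(1)
    unfolding Hstar_gHstar_continuous_map_def Hstar_open_in_def S_def T_def by blast+
  \<comment> \<open>No point maps into both \<open>U\<close> and \<open>V\<close>.\<close>
  have "topspace X \<subseteq> S \<union> T"
    using assms(2) UV unfolding Hstar_gHstar_continuous_map_def S_def T_def disjnt_def by auto
  then have "disjnt (topspace X - Hstar_cl X S) (topspace X - Hstar_cl X T)"
    using subset_Hstar_cl[of S X] subset_Hstar_cl[of T X] unfolding disjnt_def by blast
  moreover have "Hstar_open_in X (topspace X - Hstar_cl X S)"
    "Hstar_open_in X (topspace X - Hstar_cl X T)"
    unfolding S_def T_def by (auto intro!: Hstar_open_in_complement Hstar_closed_in_Hstar_cl)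
  moreover have "A \<inter> Hstar_cl X S = {}" "B \<inter> Hstar_cl X T = {}"
    using gHstar_closed_in_Hstar_cl_disjoint[OF S, of A]
      gHstar_closed_in_Hstar_cl_disjoint[OF T, of B] AB U(2) V(2)
    unfolding S_def T_def by blast+
  ultimately show "\<exists>U V. Hstar_open_in X U \<and> Hstar_open_in X V \<and> disjnt U V \<and> A \<subseteq> U \<and> B \<subseteq> V"
    using sub by blast
qed

end
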